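(* Let $s\ge 2$ and let $1\le n_1\le\cdots\le n_s$ be integers. Suppose $G$ is a graph homeomorphic to the complete $s$-partite graph $K_{n_1,\dots,n_s}$. Then $G$ admits a divisor $D$ of degree $\sum_{i=1}^{s-1}n_i$ and rank at least one. Furthermore, the gonality of $G$ is precisely $\sum_{i=1}^{s-1}n_i$.
   Context: The complete $s$-partite graph $K_{n_1,\dots,n_s}$ has vertex set $V_1\sqcup\cdots\sqcup V_s$ with $|V_i|=n_i$ and exactly one edge between each $v\in V_i$ and $w\in V_j$ when $i\ne j$, and no other edges. Here $G$ is homeomorphic to $K_{n_1,\dots,n_s}$ if it is obtained from it by inserting bivalent vertices (any number, possibly zero) on each of its edges. A divisor on a finite connected graph $G$ is a formal $\mathbb{Z}$-linear combination $D=\sum_{v\in V(G)}D(v)\cdot v$; its degree is $\sum_v D(v)$; it is effective if $D(v)\ge 0$ for all $v$. Firing a vertex $v$ sends one chip from $v$ along each non-loop edge at $v$ to its other endpoint: for each $w\ne v$, $D(w)$ increases by the number of edges between $v$ and $w$, and $D(v)$ decreases by the total number of non-loop edges at $v$. Two divisors are linearly equivalent if they differ by a finite sequence of firing moves and their inverses. The class $[D]$ is effective if $D$ is equivalent to an effective divisor. The rank is $-1$ if $[D]$ is not effective, and otherwise it is the largest integer $k\ge 0$ such that $[D-E]$ is effective for every effective divisor $E$ of degree $k$. The gonality of $G$ is the smallest degree of a divisor on $G$ of rank at least $1$. *)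

theory Defs
  imports "Graph_Theory.Subdivision" "HOL-Library.Disjoint_Sets"
begin

text \<open>
  As in Graph_Theory, an undirected graph is a symmetric digraph: every edge is a pair of
  mutually reverse arcs. The number of edges between \<open>v\<close> and \<open>w \<noteq> v\<close> is thus the number of
  arcs from \<open>v\<close> to \<open>w\<close>, and the number of non-loop edges at \<open>v\<close> is the number of non-loop
  arcs with tail \<open>v\<close>.
\<close>

text \<open>
  The analogue of the complete bipartite digraphs of Graph_Theory for \<open>s\<close> parts; the
  predicate \<^locale>\<open>graph\<close> provides finiteness and at most one arc per ordered pair.
\<close>

definition complete_multipartite_digraph ::
    "nat \<Rightarrow> (nat \<Rightarrow> nat) \<Rightarrow> ('a, 'b) pre_digraph \<Rightarrow> bool" where
  "complete_multipartite_digraph s n K \<longleftrightarrow>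
     graph K \<and>
     (\<exists>V. verts K = (\<Union>i\<in>{1..s}. V i) \<and> disjoint_family_on V {1..s} \<and>
          (\<forall>i\<in>{1..s}. card (V i) = n i) \<and>
          arcs_ends K = {(v, w). \<exists>i\<in>{1..s}. \<exists>j\<in>{1..s}. i \<noteq> j \<and> v \<in> V i \<and> w \<in> V j})"

text \<open>Divisors are integer-valued functions, normalised to be 0 outside the vertex set.\<close>

definition divisors :: "('a, 'b) pre_digraph \<Rightarrow> ('a \<Rightarrow> int) set" where
  "divisors G = {D. \<forall>v. v \<notin> verts G \<longrightarrow> D v = 0}"

definition divisor_degree :: "('a, 'b) pre_digraph \<Rightarrow> ('a \<Rightarrow> int) \<Rightarrow> int" where
  "divisor_degree G D = (\<Sum>v\<in>verts G. D v)"

definition effective :: "('a, 'b) pre_digraph \<Rightarrow> ('a \<Rightarrow> int) \<Rightarrow> bool" where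
  "effective G D \<longleftrightarrow> (\<forall>v\<in>verts G. 0 \<le> D v)"

definition fire :: "('a, 'b) pre_digraph \<Rightarrow> 'a \<Rightarrow> ('a \<Rightarrow> int) \<Rightarrow> ('a \<Rightarrow> int)" where
  "fire G v D = (\<lambda>w.
     if w = v then D v - int (card {e \<in> out_arcs G v. head G e \<noteq> v})
     else D w + int (card {e \<in> out_arcs G v. head G e = w}))"

text \<open>
  The equivalence closure is exactly reachability by finite sequences of firings and
  inverse firings.
\<close>

definition linearly_equivalent ::
    "('a, 'b) pre_digraph \<Rightarrow> ('a \<Rightarrow> int) \<Rightarrow> ('a \<Rightarrow> int) \<Rightarrow> bool" where
  "linearly_equivalent G = equivclp (\<lambda>D D'. \<exists>v\<in>verts G. D' = fire G v D)"

definition effective_class :: "('a, 'b) pre_digraph \<Rightarrow> ('a \<Rightarrow> int) \<Rightarrow> bool" where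
  "effective_class G D \<longleftrightarrow> (\<exists>D'\<in>divisors G. linearly_equivalent G D D' \<and> effective G D')"

definition divisor_rank :: "('a, 'b) pre_digraph \<Rightarrow> ('a \<Rightarrow> int) \<Rightarrow> int" where
  "divisor_rank G D =
     (if effective_class G D
      then int (GREATEST k. \<forall>E\<in>divisors G. effective G E \<and> divisor_degree G E = int k \<longrightarrow>
                  effective_class G (\<lambda>v. D v - E v))
      else - 1)"

definition gonality :: "('a, 'b) pre_digraph \<Rightarrow> int" where
  "gonality G = (LEAST d. \<exists>D\<in>divisors G. divisor_degree G D = d \<and> 1 \<le> divisor_rank G D)"

end

theory Submission
  imports Defs
begin

text \<open>
  Two divisors are equivalent iff they differ by the Laplacian of an integer function \<open>f\<close>.

  Upper bound: put one chip on every vertex of the parts \<open>1, \<dots>, s-1\<close>. What remains of \<open>G\<close> is a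
  forest to each of whose components a chip vertex sends at most one edge. Hence, to reach a
  vertex \<open>x\<close>, one can fire the complement of the chip-free component of \<open>x\<close>, which then shrinks,
  and repeat.

  Lower bound: suppose \<open>D\<close> has positive rank and degree below \<open>N = n 1 + \<dots> + n (s-1)\<close>. Any cut of
  \<open>G\<close> separating two vertices of \<open>K\<close> has at least \<open>N\<close> edges, and passing from one effective divisor
  to another by \<open>f\<close> moves a chip along every edge leaving a superlevel set of \<open>f\<close>. So \<open>f\<close> is constant
  on the vertices of \<open>K\<close>. Take an effective representative that occupies as many vertices
  of \<open>K\<close> as possible; some vertex of \<open>K\<close> is empty, and if \<open>f\<close> brings a chip there, then truncating \<open>f\<close>
  from below at its value on \<open>K\<close> does so without emptying any other vertex of \<open>K\<close>.
\<close>

section \<open>The graph Laplacian and linear equivalence\<close>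

text \<open>The sign makes \<open>f v\<close> the number of times that \<open>v\<close> fires.
  Summing over neighbours suffices because a pair digraph has no parallel arcs.\<close>

definition laplacian :: "'a pair_pre_digraph \<Rightarrow> ('a \<Rightarrow> int) \<Rightarrow> 'a \<Rightarrow> int" where
  "laplacian G f v = (\<Sum>w\<in>parcs G `` {v}. f w - f v)"

text \<open>Each undirected cut edge gives one arc here, whereas \<open>inner_arcs\<close> contains
  both arcs of an inner edge.\<close>

definition cut_arcs :: "'a pair_pre_digraph \<Rightarrow> 'a set \<Rightarrow> ('a \<times> 'a) set" where
  "cut_arcs G U = parcs G \<inter> U \<times> - U"

definition inner_arcs :: "'a pair_pre_digraph \<Rightarrow> 'a set \<Rightarrow> ('a \<times> 'a) set" where
  "inner_arcs G Y = parcs G \<inter> Y \<times> Y"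

lemma laplacian_add: "laplacian G (\<lambda>v. f v + g v) v = laplacian G f v + laplacian G g v"
  unfolding laplacian_def sum.distrib[symmetric] by (rule sum.cong) auto

lemma laplacian_diff: "laplacian G (\<lambda>v. f v - g v) v = laplacian G f v - laplacian G g v"
  unfolding laplacian_def sum_subtractf[symmetric] by (rule sum.cong) auto

lemma laplacian_const [simp]: "laplacian G (\<lambda>v. c) v = 0"
  by (simp add: laplacian_def)

text \<open>Used to compare a firing function with its truncation: with the value at
  \<open>v\<close> fixed, larger values at the neighbours send more chips to
  \<open>v\<close>.\<close>

lemma laplacian_mono:
  assumes "\<And>w. f w \<le> g w" "f v = g v"
  shows "laplacian G f v \<le> laplacian G g v"
  unfolding laplacian_def using assms by (intro sum_mono) auto

context pair_graph
begin

lemma finite_neighbours [simp, intro]: "finite (parcs G `` {v})"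
  by (rule finite_subset[OF _ pair_finite_verts]) (auto dest: in_arcsD2)

lemma laplacian_outside: "v \<notin> pverts G \<Longrightarrow> laplacian G f v = 0"
  unfolding laplacian_def by (rule sum.neutral) (auto dest: in_arcsD1)

lemma fire_eq_laplacian:
  "fire (with_proj G) v D = (\<lambda>w. D w + laplacian G (\<lambda>u. of_bool (u = v)) w)"
proof
  fix w
  have deg: "{e \<in> out_arcs (with_proj G) v. snd e \<noteq> v} = Pair v ` (parcs G `` {v})"
    by (auto dest: no_loops' simp: image_iff)
  have one: "{e \<in> out_arcs (with_proj G) v. snd e = w} = (if (v, w) \<in> parcs G then {(v, w)} else {})"
    by auto
  show "fire (with_proj G) v D w = D w + laplacian G (\<lambda>u. of_bool (u = v)) w"
  proof (cases "w = v")
    case True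
    have "laplacian G (\<lambda>u. of_bool (u = v)) v = (\<Sum>w\<in>parcs G `` {v}. - 1)"
      unfolding laplacian_def by (rule sum.cong) (auto dest: no_loops')
    then show ?thesis
      using True unfolding fire_def by (simp add: deg[simplified] card_image inj_on_def)
  next
    case False
    have "laplacian G (\<lambda>u. of_bool (u = v)) w = (\<Sum>u\<in>parcs G `` {w}. if u = v then 1 else 0)"
      unfolding laplacian_def using False by (intro sum.cong) auto
    also have "\<dots> = (if (w, v) \<in> parcs G then 1 else 0)"
      by (subst sum.delta) auto
    \<comment> \<open>The Laplacian at \<open>w\<close> sees the arc from \<open>w\<close> to
      \<open>v\<close>, firing counts the arc from \<open>v\<close> to \<open>w\<close>; symmetry
      identifies them.\<close>
    also have "\<dots> = int (card {e \<in> out_arcs (with_proj G) v. snd e = w})"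
      unfolding one using arcs_symmetric by auto
    finally show ?thesis
      using False by (simp add: fire_def)
  qed
qed

lemma linearly_equivalent_trans:
  "linearly_equivalent H D E \<Longrightarrow> linearly_equivalent H E F \<Longrightarrow> linearly_equivalent H D F"
  unfolding linearly_equivalent_def by (rule equivclp_trans)

lemma linearly_equivalent_sym:
  "linearly_equivalent H D E \<Longrightarrow> linearly_equivalent H E D"
  unfolding linearly_equivalent_def by (rule equivclp_sym)

lemma linearly_equivalent_fire_multiple:
  assumes "v \<in> pverts G"
  shows "linearly_equivalent (with_proj G) D
    (\<lambda>w. D w + c * laplacian G (\<lambda>u. of_bool (u = v)) w)"
proof -
  have nonneg: "linearly_equivalent (with_proj G) D
      (\<lambda>w. D w + int m * laplacian G (\<lambda>u. of_bool (u = v)) w)" for m D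
  proof (induction m)
    case 0
    show ?case by (simp add: linearly_equivalent_def)
  next
    case (Suc m)
    have "linearly_equivalent (with_proj G)
        (\<lambda>w. D w + int m * laplacian G (\<lambda>u. of_bool (u = v)) w)
        (fire (with_proj G) v (\<lambda>w. D w + int m * laplacian G (\<lambda>u. of_bool (u = v)) w))"
      unfolding linearly_equivalent_def using assms by (intro r_into_equivclp) auto
    from linearly_equivalent_trans[OF Suc this] show ?case
      by (simp add: fire_eq_laplacian algebra_simps)
  qed
  show ?thesis
  proof (cases "0 \<le> c")
    case True
    then show ?thesis using nonneg[of D "nat c"] by simp
  next
    case False
    \<comment> \<open>For negative \<open>c\<close>, firing \<open>- c\<close> times leads from the
      target back to \<open>D\<close>.\<close>
    then show ?thesis
      using linearly_equivalent_sym[OF nonneg[of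
        "\<lambda>w. D w + c * laplacian G (\<lambda>u. of_bool (u = v)) w" "nat (- c)"]]
      by simp
  qed
qed

text \<open>A firing or inverse firing changes \<open>f\<close> by the indicator of a vertex;
  conversely, a given \<open>f\<close> is realised one vertex at a time.\<close>

lemma linearly_equivalent_iff_laplacian:
  "linearly_equivalent (with_proj G) D D' \<longleftrightarrow> (\<exists>f. D' = (\<lambda>v. D v + laplacian G f v))"
proof
  assume "linearly_equivalent (with_proj G) D D'"
  then show "\<exists>f. D' = (\<lambda>v. D v + laplacian G f v)"
    unfolding linearly_equivalent_def
  proof (induction rule: equivclp_induct)
    case base
    show ?case by (rule exI[of _ "\<lambda>_. 0"]) simp
  next
    case (step D1 D2)
    then obtain f where f: "D1 = (\<lambda>v. D v + laplacian G f v)" by blast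
    from step obtain v where "D2 = fire (with_proj G) v D1 \<or> D1 = fire (with_proj G) v D2" by blast
    then show ?case
    proof
      assume "D2 = fire (with_proj G) v D1"
      then have "D2 = (\<lambda>w. D w + laplacian G (\<lambda>u. f u + of_bool (u = v)) w)"
        by (simp only: f laplacian_add fire_eq_laplacian add.assoc)
      then show ?thesis by blast
    next
      assume D1: "D1 = fire (with_proj G) v D2"
      have "D2 = (\<lambda>w. D w + laplacian G (\<lambda>u. f u - of_bool (u = v)) w)"
      proof
        fix w
        show "D2 w = D w + laplacian G (\<lambda>u. f u - of_bool (u = v)) w"
          using fun_cong[OF D1, of w] by (simp only: f laplacian_diff fire_eq_laplacian)
      qed
      then show ?thesis by blast
    qed
  qed
next
  assume "\<exists>f. D' = (\<lambda>v. D v + laplacian G f v)"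
  then obtain f where D': "D' = (\<lambda>v. D v + laplacian G f v)" by blast
  have partial: "linearly_equivalent (with_proj G) D
      (\<lambda>w. D w + (\<Sum>v\<in>A. f v * laplacian G (\<lambda>u. of_bool (u = v)) w))"
    if "finite A" "A \<subseteq> pverts G" for A
    using that
  proof (induction A rule: finite_induct)
    case empty
    show ?case by (simp add: linearly_equivalent_def)
  next
    case (insert a A)
    have "linearly_equivalent (with_proj G) D
      (\<lambda>w. D w + (\<Sum>v\<in>A. f v * laplacian G (\<lambda>u. of_bool (u = v)) w))"
      using insert by simp
    from linearly_equivalent_trans[OF this linearly_equivalent_fire_multiple[of a _ "f a"]]
    show ?case using insert by (simp add: algebra_simps)
  qed
  \<comment> \<open>Expands \<open>f\<close> in vertex indicators; neighbours lie in
    \<open>pverts G\<close>, so only values of \<open>f\<close> there enter the Laplacian.\<close>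
  have "(\<Sum>v\<in>pverts G. f v * laplacian G (\<lambda>u. of_bool (u = v)) w) = laplacian G f w" for w
  proof -
    have "(\<Sum>v\<in>pverts G. f v * laplacian G (\<lambda>u. of_bool (u = v)) w)
        = (\<Sum>u\<in>parcs G `` {w}. \<Sum>v\<in>pverts G. f v * (of_bool (u = v) - of_bool (w = v)))"
      unfolding laplacian_def sum_distrib_left by (rule sum.swap)
    also have "\<dots> = (\<Sum>u\<in>parcs G `` {w}. f u - f w)"
    proof (rule sum.cong[OF refl])
      fix u assume "u \<in> parcs G `` {w}"
      then have uw: "u \<in> pverts G" "w \<in> pverts G" by (auto dest: wellformed')
      have "(\<Sum>v\<in>pverts G. f v * (of_bool (u = v) - of_bool (w = v)))
          = (\<Sum>v\<in>pverts G. if u = v then f v else 0) - (\<Sum>v\<in>pverts G. if w = v then f v else 0)"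
        unfolding sum_subtractf[symmetric] by (rule sum.cong) auto
      also have "\<dots> = f u - f w"
        using uw pair_finite_verts by simp
      finally show "(\<Sum>v\<in>pverts G. f v * (of_bool (u = v) - of_bool (w = v))) = f u - f w" .
    qed
    finally show ?thesis unfolding laplacian_def .
  qed
  then show "linearly_equivalent (with_proj G) D D'"
    using partial[OF pair_finite_verts subset_refl] by (simp add: D')
qed

lemma finite_inner_arcs [simp]: "finite (inner_arcs G Y)"
  unfolding inner_arcs_def using pair_finite_arcs by simp

lemma finite_cut_arcs [simp]: "finite (cut_arcs G U)"
  unfolding cut_arcs_def using pair_finite_arcs by simp

text \<open>A discrete divergence theorem: the two arcs of an edge inside \<open>U\<close>
  contribute opposite terms, so only the boundary remains.\<close>

lemma sum_laplacian:
  assumes "U \<subseteq> pverts G"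
  shows "(\<Sum>v\<in>U. laplacian G f v) = (\<Sum>(v, w)\<in>cut_arcs G U. f w - f v)"
proof -
  have fin: "finite U" using assms pair_finite_verts by (rule finite_subset)
  have "(\<Sum>v\<in>U. laplacian G f v) = (\<Sum>(v, w)\<in>(SIGMA v:U. parcs G `` {v}). f w - f v)"
    unfolding laplacian_def using fin by (subst sum.Sigma) auto
  also have "(SIGMA v:U. parcs G `` {v}) = inner_arcs G U \<union> cut_arcs G U"
    by (auto simp: inner_arcs_def cut_arcs_def)
  also have "(\<Sum>(v, w)\<in>inner_arcs G U \<union> cut_arcs G U. f w - f v)
      = (\<Sum>(v, w)\<in>inner_arcs G U. f w - f v) + (\<Sum>(v, w)\<in>cut_arcs G U. f w - f v)"
    by (rule sum.union_disjoint) (auto simp: inner_arcs_def cut_arcs_def pair_finite_arcs)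
  also have "(\<Sum>(v, w)\<in>inner_arcs G U. f w - f v) = 0"
  proof -
    have "(\<Sum>(v, w)\<in>inner_arcs G U. f w) = (\<Sum>(v, w)\<in>inner_arcs G U. f v)"
      by (rule sum.reindex_bij_witness[of _ prod.swap prod.swap])
        (auto simp: inner_arcs_def intro: arcs_symmetric)
    then show ?thesis by (simp add: case_prod_unfold sum_subtractf)
  qed
  finally show ?thesis by simp
qed

lemma sum_laplacian_verts: "(\<Sum>v\<in>pverts G. laplacian G f v) = 0"
proof -
  have "cut_arcs G (pverts G) = {}" by (auto simp: cut_arcs_def dest: in_arcsD2)
  then show ?thesis by (simp add: sum_laplacian)
qed

section \<open>Effectiveness and rank at least one in terms of firing functions\<close>

lemma effective_class_iff:
  assumes "D \<in> divisors (with_proj G)"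
  shows "effective_class (with_proj G) D \<longleftrightarrow> (\<exists>f. \<forall>v\<in>pverts G. 0 \<le> D v + laplacian G f v)"
proof -
  have "(\<lambda>v. D v + laplacian G f v) \<in> divisors (with_proj G)" for f
    using assms by (auto simp: divisors_def laplacian_outside)
  then show ?thesis
    unfolding effective_class_def linearly_equivalent_iff_laplacian effective_def
    by fastforce
qed

text \<open>An effective divisor of degree one is a single chip, so positive rank means that a chip
  can be brought to each vertex \<open>q\<close>.\<close>

lemma one_le_rank_iff:
  assumes D: "D \<in> divisors (with_proj G)" and ne: "pverts G \<noteq> {}"
  shows "1 \<le> divisor_rank (with_proj G) D \<longleftrightarrow>
    (\<forall>q\<in>pverts G. \<exists>f. (\<forall>v\<in>pverts G. 0 \<le> D v + laplacian G f v) \<and> 1 \<le> D q + laplacian G f q)"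
    (is "_ \<longleftrightarrow> ?R")
proof -
  let ?H = "with_proj G"
  let ?P = "\<lambda>k. \<forall>E\<in>divisors ?H. effective ?H E \<and> divisor_degree ?H E = int k \<longrightarrow>
                  effective_class ?H (\<lambda>v. D v - E v)"
  have sub: "(\<lambda>v. D v - E v) \<in> divisors ?H" if "E \<in> divisors ?H" for E
    using D that by (auto simp: divisors_def)
  have single: "(\<lambda>v. if v = q then int k else 0) \<in> divisors ?H"
    "effective ?H (\<lambda>v. if v = q then int k else 0)"
    "divisor_degree ?H (\<lambda>v. if v = q then int k else 0) = int k" if "q \<in> pverts G" for q k
    using that pair_finite_verts by (auto simp: divisors_def effective_def divisor_degree_def)
  have chips: "\<exists>f. (\<forall>v\<in>pverts G. 0 \<le> D v + laplacian G f v) \<and> int k \<le> D q + laplacian G f q"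
    if P: "?P k" and q: "q \<in> pverts G" for k q
  proof -
    from P single[OF q] have "effective_class ?H (\<lambda>v. D v - (if v = q then int k else 0))"
      by blast
    then obtain f where
      f: "\<forall>v\<in>pverts G. 0 \<le> D v - (if v = q then int k else 0) + laplacian G f v"
      using effective_class_iff[OF sub[OF single(1)[OF q]]] by blast
    have "0 \<le> D v + laplacian G f v" if "v \<in> pverts G" for v
      using f[rule_format, OF that] by (auto split: if_splits)
    moreover have "int k \<le> D q + laplacian G f q"
      using f[rule_format, OF q] by simp
    ultimately show ?thesis by blast
  qed
  \<comment> \<open>Demanding all \<open>k\<close> chips at one vertex bounds \<open>k\<close> by
    the degree, so the \<open>GREATEST\<close> is attained.\<close>
  have bound: "k \<le> nat (divisor_degree ?H D)" if P: "?P k" for k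
  proof -
    obtain q where q: "q \<in> pverts G" using ne by blast
    obtain f where f: "\<forall>v\<in>pverts G. 0 \<le> D v + laplacian G f v" "int k \<le> D q + laplacian G f q"
      using chips[OF P q] by blast
    have "D q + laplacian G f q \<le> (\<Sum>v\<in>pverts G. D v + laplacian G f v)"
      using f q by (intro member_le_sum) (auto simp: pair_finite_verts)
    then have "int k \<le> (\<Sum>v\<in>pverts G. D v)"
      using f by (simp add: sum.distrib sum_laplacian_verts)
    then show ?thesis by (simp add: divisor_degree_def)
  qed
  show ?thesis
  proof
    assume rank: "1 \<le> divisor_rank ?H D"
    then have eff: "effective_class ?H D" by (auto simp: divisor_rank_def split: if_splits)
    \<comment> \<open>Only the zero divisor is effective of degree 0. This gives
      \<open>GreatestI_nat\<close> a value satisfying \<open>?P\<close>.\<close>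
    have "?P 0"
    proof (intro ballI impI, elim conjE)
      fix E assume E: "E \<in> divisors ?H" "effective ?H E" "divisor_degree ?H E = int 0"
      have "\<forall>v\<in>pverts G. E v = 0"
        using E pair_finite_verts by (simp add: effective_def divisor_degree_def sum_nonneg_eq_0_iff)
      then have "E v = 0" for v using E by (auto simp: divisors_def)
      then show "effective_class ?H (\<lambda>v. D v - E v)" using eff by simp
    qed
    then have P: "?P (GREATEST k. ?P k)"
      by (rule GreatestI_nat) (use bound in blast)
    have ge: "1 \<le> (GREATEST k. ?P k)"
      using rank eff by (simp add: divisor_rank_def)
    show ?R
    proof
      fix q assume "q \<in> pverts G"
      from chips[OF P this] ge
      show "\<exists>f. (\<forall>v\<in>pverts G. 0 \<le> D v + laplacian G f v) \<and> 1 \<le> D q + laplacian G f q"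
        by (smt (verit) of_nat_1 of_nat_mono)
    qed
  next
    assume R: ?R
    then have eff: "effective_class ?H D"
      using ne by (auto simp: effective_class_iff[OF D])
    have "?P 1"
    proof (intro ballI impI, elim conjE)
      fix E assume E: "E \<in> divisors ?H" "effective ?H E" "divisor_degree ?H E = int 1"
      then have nonneg: "\<forall>v\<in>pverts G. 0 \<le> E v" by (simp add: effective_def)
      have sum: "(\<Sum>v\<in>pverts G. E v) = 1" using E by (simp add: divisor_degree_def)
      \<comment> \<open>Nonnegative integers with sum 1: \<open>E\<close> is one chip, placed at
        \<open>q\<close>.\<close>
      then obtain q where q: "q \<in> pverts G" "E q \<noteq> 0"
        by (metis sum.neutral zero_neq_one)
      have Eq: "1 \<le> E q" using nonneg q by force
      have rest: "(\<Sum>v\<in>pverts G. E v) = E q + (\<Sum>v\<in>pverts G - {q}. E v)"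
        using q pair_finite_verts by (simp add: sum.remove)
      have "0 \<le> (\<Sum>v\<in>pverts G - {q}. E v)" using nonneg by (intro sum_nonneg) auto
      then have q1: "E q = 1" and "(\<Sum>v\<in>pverts G - {q}. E v) = 0"
        using rest sum Eq by linarith+
      then have z: "\<forall>v\<in>pverts G - {q}. E v = 0"
        using nonneg pair_finite_verts by (subst (asm) sum_nonneg_eq_0_iff) auto
      obtain f where f: "\<forall>v\<in>pverts G. 0 \<le> D v + laplacian G f v" "1 \<le> D q + laplacian G f q"
        using R q by blast
      have "0 \<le> D v - E v + laplacian G f v" if "v \<in> pverts G" for v
        using f z q1 that by (cases "v = q") auto
      then show "effective_class ?H (\<lambda>v. D v - E v)"
        unfolding effective_class_iff[OF sub[OF E(1)]] by blast
    qed
    then have "1 \<le> (GREATEST k. ?P k)"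
      by (rule Greatest_le_nat) (use bound in blast)
    then show "1 \<le> divisor_rank ?H D" using eff by (simp add: divisor_rank_def)
  qed
qed

section \<open>Degree bounds for divisors of positive rank\<close>

text \<open>Only cuts that separate \<open>S\<close> have to be large. This allows \<open>S\<close>
  to be the vertex set of the original graph inside a subdivision, where other cuts may be
  small.\<close>

theorem degree_lower_bound_of_cuts:
  assumes D: "D \<in> divisors (with_proj G)" and rank: "1 \<le> divisor_rank (with_proj G) D"
    and S: "S \<subseteq> pverts G" "S \<noteq> {}" "k \<le> card S"
    and cut: "\<And>U. S \<inter> U \<noteq> {} \<Longrightarrow> S - U \<noteq> {} \<Longrightarrow> k \<le> card (cut_arcs G U)"
  shows "int k \<le> divisor_degree (with_proj G) D"
proof (rule ccontr)
  assume "\<not> int k \<le> divisor_degree (with_proj G) D"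
  then have less: "(\<Sum>v\<in>pverts G. D v) < int k" by (simp add: divisor_degree_def)
  define eff where "eff f \<longleftrightarrow> (\<forall>v\<in>pverts G. 0 \<le> D v + laplacian G f v)" for f
  define hit where "hit f = {v \<in> S. 1 \<le> D v + laplacian G f v}" for f
  have ne: "pverts G \<noteq> {}" using S by blast
  have reach: "\<exists>f. eff f \<and> 1 \<le> D q + laplacian G f q" if "q \<in> pverts G" for q
    using rank that unfolding one_le_rank_iff[OF D ne] eff_def by blast
  have finS: "finite S" using S pair_finite_verts by (metis finite_subset)
  have deg: "(\<Sum>v\<in>pverts G. D v + laplacian G f v) = (\<Sum>v\<in>pverts G. D v)" for f
    by (simp add: sum.distrib sum_laplacian_verts)
  obtain e where "eff e" using reach ne by blast
  moreover have "card (hit f) < Suc (card S)" for f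
    unfolding less_Suc_eq_le hit_def using finS by (intro card_mono) auto
  \<comment> \<open>Extremal choice: \<open>f0\<close> leads to an effective divisor occupying as
    many vertices of \<open>S\<close> as possible.\<close>
  ultimately have "\<exists>f0. eff f0 \<and> (\<forall>f. eff f \<longrightarrow> card (hit f) \<le> card (hit f0))"
    by (intro ex_has_greatest_nat[where b = "Suc (card S)"]) simp_all
  then obtain f0 where f0: "eff f0" and max: "\<And>f. eff f \<Longrightarrow> card (hit f) \<le> card (hit f0)"
    by blast
  \<comment> \<open>The degree is below \<open>k\<close>, hence below \<open>card S\<close>, so some
    vertex of \<open>S\<close> is empty.\<close>
  have "\<exists>q\<in>S. D q + laplacian G f0 q < 1"
  proof (rule ccontr)
    assume "\<not> (\<exists>q\<in>S. D q + laplacian G f0 q < 1)"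
    then have "int (card S) \<le> (\<Sum>v\<in>S. D v + laplacian G f0 v)"
      using sum_mono[of S "\<lambda>_. 1" "\<lambda>v. D v + laplacian G f0 v"] by fastforce
    also have "\<dots> \<le> (\<Sum>v\<in>pverts G. D v + laplacian G f0 v)"
      using S f0 pair_finite_verts by (intro sum_mono2) (auto simp: eff_def)
    finally show False using less S deg by simp
  qed
  then obtain q where q: "q \<in> S" "D q + laplacian G f0 q < 1" by blast
  then obtain f1 where f1: "eff f1" "1 \<le> D q + laplacian G f1 q" using reach S by blast
  \<comment> \<open>Firing \<open>g\<close> leads from the effective divisor of \<open>f0\<close> to
    that of \<open>f1\<close>.\<close>
  define g where "g v = f1 v - f0 v" for v
  have lap_g: "D v + laplacian G f1 v = D v + laplacian G f0 v + laplacian G g v" for v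
    unfolding g_def laplacian_diff by simp
  have le: "g p \<le> g r" if "p \<in> S" "r \<in> S" for p r
  proof (rule ccontr)
    assume less_g: "\<not> g p \<le> g r"
    \<comment> \<open>Along each arc leaving this superlevel set the integer function
      \<open>g\<close> drops by at least 1, so \<open>U\<close> loses at least \<open>k\<close>
      chips. It holds fewer than \<open>k\<close> and cannot become negative.\<close>
    define U where "U = {v \<in> pverts G. g p \<le> g v}"
    have U: "U \<subseteq> pverts G" by (auto simp: U_def)
    have "p \<in> U" "r \<notin> U" using that less_g S by (auto simp: U_def)
    then have k: "k \<le> card (cut_arcs G U)" using that by (intro cut) auto
    have "(\<Sum>v\<in>U. laplacian G g v) \<le> (\<Sum>(v, w)\<in>cut_arcs G U. - 1)"
      unfolding sum_laplacian[OF U]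
      by (intro sum_mono) (auto simp: cut_arcs_def U_def dest: in_arcsD2)
    also have "\<dots> = - int (card (cut_arcs G U))" by (simp add: case_prod_unfold)
    finally have "(\<Sum>v\<in>U. laplacian G g v) \<le> - int k" using k by linarith
    moreover have "0 \<le> (\<Sum>v\<in>U. D v + laplacian G f1 v)"
      using f1 U by (intro sum_nonneg) (auto simp: eff_def)
    moreover have "(\<Sum>v\<in>U. D v + laplacian G f0 v) \<le> (\<Sum>v\<in>pverts G. D v + laplacian G f0 v)"
      using U f0 pair_finite_verts by (intro sum_mono2) (auto simp: eff_def)
    ultimately show False
      unfolding lap_g deg using less by (simp add: sum.distrib)
  qed
  \<comment> \<open>Truncation of \<open>g\<close> from below at its constant value on
    \<open>S\<close>, so that all of \<open>S\<close> lies at the minimum of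
    \<open>h\<close>.\<close>
  define h where "h v = max (g v) (g q)" for v
  have hS: "h v = g v" "h v = g q" if "v \<in> S" for v
    using le that q by (auto simp: h_def intro: antisym)
  \<comment> \<open>Untruncated vertices end with at least the chips that \<open>f1\<close> leaves
    them; vertices at the minimum of \<open>h\<close> lose none.\<close>
  have h_g: "laplacian G g v \<le> laplacian G h v" if "h v = g v" for v
    using that by (intro laplacian_mono) (auto simp: h_def)
  have h_0: "0 \<le> laplacian G h v" if "h v = g q" for v
  proof -
    have "g q \<le> h w" for w by (simp add: h_def)
    from laplacian_mono[of "\<lambda>_. g q" h v G, OF this that[symmetric]] show ?thesis by simp
  qed
  have lap_h: "D v + laplacian G (\<lambda>v. f0 v + h v) v
      = D v + laplacian G f0 v + laplacian G h v" for v
    by (simp add: laplacian_add)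
  have "eff (\<lambda>v. f0 v + h v)"
    unfolding eff_def lap_h
  proof
    fix v assume v: "v \<in> pverts G"
    consider "h v = g v" | "h v = g q" unfolding h_def max_def by argo
    then show "0 \<le> D v + laplacian G f0 v + laplacian G h v"
    proof cases
      case 1
      then show ?thesis using h_g f1(1) v lap_g[of v] unfolding eff_def by fastforce
    next
      case 2
      then show ?thesis using h_0 f0 v unfolding eff_def by fastforce
    qed
  qed
  moreover have "card (hit f0) < card (hit (\<lambda>v. f0 v + h v))"
  proof (rule psubset_card_mono)
    show "finite (hit (\<lambda>v. f0 v + h v))" using finS by (simp add: hit_def)
    \<comment> \<open>No vertex of \<open>S\<close> loses chips, being at the minimum of
      \<open>h\<close>; at \<open>q\<close> also \<open>h = g\<close>, so the chip brought by
      \<open>f1\<close> arrives.\<close>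
    have "hit f0 \<subseteq> hit (\<lambda>v. f0 v + h v)"
      using h_0 hS(2) unfolding hit_def lap_h by fastforce
    moreover have "q \<in> hit (\<lambda>v. f0 v + h v)"
      using q f1(2) h_g[OF hS(1)[OF q(1)]] lap_g[of q] unfolding hit_def lap_h by simp
    moreover have "q \<notin> hit f0" using q by (simp add: hit_def)
    ultimately show "hit f0 \<subset> hit (\<lambda>v. f0 v + h v)" by blast
  qed
  ultimately show False using max by fastforce
qed

end

section \<open>Connected sets, forests and the upper bound\<close>

inductive connected_from :: "'a pair_pre_digraph \<Rightarrow> 'a \<Rightarrow> 'a set \<Rightarrow> bool"
  for G :: "'a pair_pre_digraph" and x :: 'a where
  single: "connected_from G x {x}"
| extend: "connected_from G x X \<Longrightarrow> y \<in> X \<Longrightarrow> (y, z) \<in> parcs G \<Longrightarrow> z \<notin> X \<Longrightarrow>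
    connected_from G x (insert z X)"

text \<open>
  Every cycle of \<open>G\<close> meets \<open>U\<close> in at least two vertices. Counting arcs (two per edge) makes
  this stable under subdivision.
\<close>

definition forest_off :: "'a pair_pre_digraph \<Rightarrow> 'a set \<Rightarrow> bool" where
  "forest_off G U \<longleftrightarrow> (\<forall>Y\<subseteq>pverts G. Y \<noteq> {} \<longrightarrow> card (Y \<inter> U) \<le> 1 \<longrightarrow>
     card (inner_arcs G Y) + 2 \<le> 2 * card Y)"

text \<open>Connectedness in the form in which firing uses it: every proper nonempty vertex set has
  an edge across its boundary.\<close>

definition cut_connected :: "'a pair_pre_digraph \<Rightarrow> bool" where
  "cut_connected G \<longleftrightarrow> (\<forall>C\<subseteq>pverts G. C \<noteq> {} \<longrightarrow> C \<noteq> pverts G \<longrightarrow> cut_arcs G C \<noteq> {})"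

context pair_graph
begin

lemma connected_from_mem: "connected_from G x X \<Longrightarrow> x \<in> X"
  by (induction rule: connected_from.induct) auto

lemma connected_from_finite: "connected_from G x X \<Longrightarrow> finite X"
  by (induction rule: connected_from.induct) auto

text \<open>A connected set contains a spanning tree: each added vertex brings an edge to an earlier
  one, that is, two arcs.\<close>

lemma connected_from_inner_arcs:
  "connected_from G x X \<Longrightarrow> 2 * card X \<le> card (inner_arcs G X) + 2"
proof (induction rule: connected_from.induct)
  case single
  show ?case by simp
next
  case (extend X y z)
  have "inner_arcs G X \<union> {(y, z), (z, y)} \<subseteq> inner_arcs G (insert z X)"
    using extend by (auto simp: inner_arcs_def intro: arcs_symmetric)
  then have "card (inner_arcs G X \<union> {(y, z), (z, y)}) \<le> card (inner_arcs G (insert z X))"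
    by (intro card_mono) auto
  moreover have "card (inner_arcs G X \<union> {(y, z), (z, y)}) = card (inner_arcs G X) + card {(y, z), (z, y)}"
    using extend by (intro card_Un_disjoint) (auto simp: inner_arcs_def)
  moreover have "y \<noteq> z" using extend(1-4) by blast
  then have "card {(y, z), (z, y)} = 2" by simp
  moreover have "card (insert z X) = Suc (card X)"
    using extend connected_from_finite by simp
  ultimately show ?case using extend by linarith
qed

text \<open>Gives the component of \<open>x\<close> in the subgraph induced on \<open>W\<close>, as
  a connected subset of maximal cardinality.\<close>

lemma maximal_connected_from:
  assumes "x \<in> W" "finite W"
  obtains C where "connected_from G x C" "C \<subseteq> W"
    "\<And>v w. v \<in> C \<Longrightarrow> w \<in> W \<Longrightarrow> (v, w) \<in> parcs G \<Longrightarrow> w \<in> C"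
proof -
  let ?P = "\<lambda>C. connected_from G x C \<and> C \<subseteq> W"
  have bound: "\<forall>C. ?P C \<longrightarrow> card C < Suc (card W)"
    using assms by (simp add: less_Suc_eq_le card_mono)
  have base: "?P {x}" using assms by (simp add: connected_from.single)
  obtain C where C: "?P C" and max: "\<And>C'. ?P C' \<Longrightarrow> card C' \<le> card C"
    using ex_has_greatest_nat[of ?P, OF base bound] by blast
  have "w \<in> C" if vw: "v \<in> C" "w \<in> W" "(v, w) \<in> parcs G" for v w
  proof (rule ccontr)
    assume w: "w \<notin> C"
    then have "?P (insert w C)" using C vw by (auto intro: connected_from.extend)
    then have "card (insert w C) \<le> card C" by (rule max)
    moreover have "finite C" using C connected_from_finite by blast
    ultimately show False using w by simp
  qed
  with C show ?thesis using that by blast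
qed

text \<open>The effect of firing every vertex outside \<open>C\<close> once: along edges with both
  ends outside, the chips cancel.\<close>

lemma laplacian_indicator:
  "laplacian G (\<lambda>u. of_bool (u \<notin> C)) v =
    (if v \<in> C then int (card (parcs G `` {v} - C)) else - int (card (parcs G `` {v} \<inter> C)))"
proof -
  have "laplacian G (\<lambda>u. of_bool (u \<notin> C)) v
      = (\<Sum>w\<in>parcs G `` {v}. if v \<in> C then of_bool (w \<in> - C) else - of_bool (w \<in> C))"
    unfolding laplacian_def by (rule sum.cong) auto
  then show ?thesis by (simp add: sum_negf Diff_eq Compl_eq)
qed

text \<open>
  Firing everything outside \<open>C\<close> moves one chip along each edge into \<open>C\<close>; the chips that arrive
  cut off a smaller connected set around \<open>x\<close>.
\<close>

lemma chip_reaches_vertex: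
  assumes conn: "cut_connected G" and W: "W \<subset> pverts G"
    and sparse: "\<And>X v. connected_from G x X \<Longrightarrow> X \<subseteq> W \<Longrightarrow> v \<notin> X \<Longrightarrow>
      card (parcs G `` {v} \<inter> X) \<le> 1"
    and C: "connected_from G x C" "C \<subseteq> W"
    and D: "\<forall>v\<in>pverts G. 0 \<le> D v"
    and boundary: "\<And>v w. v \<notin> C \<Longrightarrow> w \<in> C \<Longrightarrow> (v, w) \<in> parcs G \<Longrightarrow> 1 \<le> D v"
  shows "\<exists>f. (\<forall>v\<in>pverts G. 0 \<le> D v + laplacian G f v) \<and> 1 \<le> D x + laplacian G f x"
  using C D boundary
proof (induction "card C" arbitrary: C D rule: less_induct)
  case less
  define f :: "'a \<Rightarrow> int" where "f = (\<lambda>u. of_bool (u \<notin> C))"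
  define D1 where "D1 = (\<lambda>v. D v + laplacian G f v)"
  have lap: "laplacian G f v =
    (if v \<in> C then int (card (parcs G `` {v} - C)) else - int (card (parcs G `` {v} \<inter> C)))" for v
    unfolding f_def by (rule laplacian_indicator)
  have eff: "0 \<le> D1 v" if v: "v \<in> pverts G" for v
  proof (cases "v \<in> C \<or> parcs G `` {v} \<inter> C = {}")
    case True
    then show ?thesis using less.prems(3) v by (auto simp: D1_def lap)
  next
    case False
    then obtain w where "w \<in> C" "(v, w) \<in> parcs G" "v \<notin> C" by blast
    moreover from this have "1 \<le> D v" using less.prems(4) by blast
    \<comment> \<open>By \<open>sparse\<close> such a vertex pays at most one chip, and by the
      boundary condition it has one.\<close>
    ultimately show ?thesis
      using sparse[OF less.prems(1,2), of v] by (simp add: D1_def lap)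
  qed
  show ?case
  proof (cases "1 \<le> D1 x")
    case True
    then show ?thesis using eff unfolding D1_def by blast
  next
    case False
    have fin: "finite C" using less.prems(1) by (rule connected_from_finite)
    \<comment> \<open>If \<open>x\<close> is still empty, \<open>C\<close> is replaced by the
      component \<open>C1\<close> of \<open>x\<close> in its chip-free part.\<close>
    have "x \<in> {v \<in> C. D1 v < 1}"
      using False connected_from_mem[OF less.prems(1)] by simp
    moreover have "finite {v \<in> C. D1 v < 1}" using fin by auto
    ultimately obtain C1 where C1: "connected_from G x C1" "C1 \<subseteq> {v \<in> C. D1 v < 1}"
      and max: "\<And>v w. v \<in> C1 \<Longrightarrow> w \<in> {v \<in> C. D1 v < 1} \<Longrightarrow> (v, w) \<in> parcs G \<Longrightarrow> w \<in> C1"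
      by (rule maximal_connected_from) blast
    have covered: "1 \<le> D1 v" if "v \<in> C" "w \<notin> C" "(v, w) \<in> parcs G" for v w
    proof -
      have "0 < card (parcs G `` {v} - C)"
        using that by (subst card_gt_0_iff) auto
      moreover have "0 \<le> D v" using that less.prems(3) by (auto dest: in_arcsD1)
      ultimately show ?thesis using that by (simp add: D1_def lap)
    qed
    \<comment> \<open>Connectedness makes at least one chip enter \<open>C\<close>, so
      \<open>C1\<close> is strictly smaller and the induction applies.\<close>
    have "cut_arcs G C \<noteq> {}"
      using conn W less.prems(2) connected_from_mem[OF less.prems(1)]
      unfolding cut_connected_def by blast
    then have "C1 \<noteq> C" using covered C1(2) by (fastforce simp: cut_arcs_def)
    then have "card C1 < card C" using C1(2) fin by (intro psubset_card_mono) auto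
    moreover have "C1 \<subseteq> W" using C1 less.prems(2) by blast
    \<comment> \<open>The boundary condition persists: inside \<open>C\<close>, a neighbour of
      \<open>C1\<close> has a chip by maximality; outside \<open>C\<close> there is none, since
      \<open>w\<close> would be covered.\<close>
    moreover have "1 \<le> D1 v" if vw: "v \<notin> C1" "w \<in> C1" "(v, w) \<in> parcs G" for v w
    proof (cases "v \<in> C")
      case True
      have "v \<notin> {v \<in> C. D1 v < 1}" using max[OF vw(2) _ arcs_symmetric[OF vw(3)]] vw(1) by blast
      then show ?thesis using True by auto
    next
      case False
      then have "1 \<le> D1 w" using covered[of w v] vw C1(2) arcs_symmetric by blast
      then show ?thesis using vw(2) C1(2) by auto
    qed
    moreover have "\<forall>v\<in>pverts G. 0 \<le> D1 v" using eff by blast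
    ultimately obtain h where h: "\<forall>v\<in>pverts G. 0 \<le> D1 v + laplacian G h v" "1 \<le> D1 x + laplacian G h x"
      using less.hyps[of C1 D1] C1(1) by blast
    have "D v + laplacian G (\<lambda>u. f u + h u) v = D1 v + laplacian G h v" for v
      by (simp add: D1_def laplacian_add)
    then have "(\<forall>v\<in>pverts G. 0 \<le> D v + laplacian G (\<lambda>u. f u + h u) v) \<and>
        1 \<le> D x + laplacian G (\<lambda>u. f u + h u) x"
      using h by simp
    then show ?thesis by (rule exI[where x = "\<lambda>u. f u + h u"])
  qed
qed

text \<open>The set \<open>insert v X\<close> meets \<open>U\<close> at most in \<open>v\<close>, so
  it spans at most \<open>2 * card X\<close> arcs. The connected set \<open>X\<close> already has
  \<open>2 * card X - 2\<close>, and each neighbour of \<open>v\<close> in \<open>X\<close> adds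
  two.\<close>

lemma forest_off_sparse:
  assumes forest: "forest_off G U" and X: "connected_from G x X" "X \<subseteq> pverts G - U" and v: "v \<notin> X"
  shows "card (parcs G `` {v} \<inter> X) \<le> 1"
proof (cases "v \<in> pverts G")
  case True
  define N where "N = parcs G `` {v} \<inter> X"
  have fin: "finite X" using X(1) by (rule connected_from_finite)
  have finN: "finite N" using fin by (simp add: N_def)
  have "insert v X \<inter> U \<subseteq> {v}" using X by blast
  then have "card (insert v X \<inter> U) \<le> 1" using card_mono[of "{v}"] by fastforce
  then have "card (inner_arcs G (insert v X)) + 2 \<le> 2 * card (insert v X)"
    using forest X True unfolding forest_off_def by (metis Diff_subset insert_not_empty insert_subset subset_trans)
  moreover have "inner_arcs G X \<union> (Pair v ` N \<union> (\<lambda>w. (w, v)) ` N) \<subseteq> inner_arcs G (insert v X)"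
    by (auto simp: inner_arcs_def N_def intro: arcs_symmetric)
  then have "card (inner_arcs G X \<union> (Pair v ` N \<union> (\<lambda>w. (w, v)) ` N)) \<le> card (inner_arcs G (insert v X))"
    by (intro card_mono) auto
  moreover have "card (inner_arcs G X \<union> (Pair v ` N \<union> (\<lambda>w. (w, v)) ` N))
      = card (inner_arcs G X) + card (Pair v ` N \<union> (\<lambda>w. (w, v)) ` N)"
    using v finN by (intro card_Un_disjoint) (auto simp: inner_arcs_def)
  moreover have "card (Pair v ` N \<union> (\<lambda>w. (w, v)) ` N) = card N + card N"
    using v finN by (subst card_Un_disjoint) (auto simp: N_def card_image inj_on_def)
  moreover have "card (insert v X) = Suc (card X)" using fin v by simp
  ultimately show ?thesis
    using connected_from_inner_arcs[OF X(1)] unfolding N_def[symmetric] by linarith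
next
  case False
  then have "parcs G `` {v} = {}" by (auto dest: in_arcsD1)
  then show ?thesis by simp
qed

lemma indicator_in_divisors:
  assumes "U \<subseteq> pverts G"
  shows "(\<lambda>v. of_bool (v \<in> U)) \<in> divisors (with_proj G)"
  using assms by (auto simp: divisors_def)

lemma degree_indicator:
  assumes "U \<subseteq> pverts G"
  shows "divisor_degree (with_proj G) (\<lambda>v. of_bool (v \<in> U)) = int (card U)"
  using assms pair_finite_verts by (simp add: divisor_degree_def Int_absorb1)

text \<open>For \<open>x\<close> outside \<open>U\<close>, firing starts from the component of
  \<open>x\<close> in the complement of \<open>U\<close>; its outer boundary lies in
  \<open>U\<close> and thus carries chips.\<close>

theorem rank_indicator_of_forest_off:
  assumes forest: "forest_off G U" and conn: "cut_connected G"
    and U: "U \<subseteq> pverts G" "U \<noteq> {}"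
  shows "1 \<le> divisor_rank (with_proj G) (\<lambda>v. of_bool (v \<in> U))"
proof -
  have "\<exists>f. (\<forall>v\<in>pverts G. 0 \<le> of_bool (v \<in> U) + laplacian G f v) \<and> 1 \<le> of_bool (x \<in> U) + laplacian G f x"
    if x: "x \<in> pverts G" for x
  proof (cases "x \<in> U")
    case True
    then show ?thesis by (intro exI[of _ "\<lambda>_. 0"]) simp
  next
    case False
    then have "x \<in> pverts G - U" using x by simp
    moreover have "finite (pverts G - U)" using pair_finite_verts by simp
    ultimately obtain C where C: "connected_from G x C" "C \<subseteq> pverts G - U"
      and max: "\<And>v w. v \<in> C \<Longrightarrow> w \<in> pverts G - U \<Longrightarrow> (v, w) \<in> parcs G \<Longrightarrow> w \<in> C"
      by (rule maximal_connected_from) blast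
    show ?thesis
    proof (rule chip_reaches_vertex[OF conn _ forest_off_sparse[OF forest] C])
      show "pverts G - U \<subset> pverts G" using U by blast
      fix v w assume vw: "v \<notin> C" "w \<in> C" "(v, w) \<in> parcs G"
      then have "v \<in> U" using max[of w v] arcs_symmetric in_arcsD1 by blast
      then show "1 \<le> (of_bool (v \<in> U) :: int)" by simp
    qed auto
  qed
  then show ?thesis
    using U by (subst one_le_rank_iff[OF indicator_in_divisors[OF U(1)]]) auto
qed

section \<open>Invariants of subdivision\<close>

text \<open>If the subdivided edge crosses the cut, so does one of its halves; which one depends on
  the side of \<open>w\<close>, and \<open>\<phi>\<close> selects it.\<close>

lemma card_cut_arcs_subdivide:
  assumes "e \<in> parcs G" "w \<notin> pverts G"
  shows "card (cut_arcs G U) \<le> card (cut_arcs (subdivide G e w) U)"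
proof -
  obtain a b where e: "e = (a, b)" by (cases e)
  interpret S: pair_graph "subdivide G e w" using assms by (rule pair_graph_subdivide)
  define \<phi> where "\<phi> x =
    (if x = (a, b) then if w \<in> U then (w, b) else (a, w)
     else if x = (b, a) then if w \<in> U then (w, a) else (b, w) else x)" for x
  have ab: "a \<noteq> b" using assms no_loops' by (simp add: e)
  have w: "(w, c) \<notin> parcs G" "(c, w) \<notin> parcs G" for c using assms by (auto dest: wellformed')
  show ?thesis
  proof (rule card_inj_on_le)
    show "inj_on \<phi> (cut_arcs G U)"
      using ab w by (auto simp: inj_on_def \<phi>_def cut_arcs_def split: if_splits)
    show "\<phi> ` cut_arcs G U \<subseteq> cut_arcs (subdivide G e w) U"
      by (auto simp: \<phi>_def cut_arcs_def e)
    show "finite (cut_arcs (subdivide G e w) U)" by simp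
  qed
qed

text \<open>Without \<open>w\<close>, the set \<open>C\<close> is either a proper nonempty vertex
  set of \<open>G\<close>, whose cut does not shrink, or trivial; then the edge between
  \<open>a\<close> and \<open>w\<close> crosses.\<close>

lemma cut_connected_subdivide:
  assumes conn: "cut_connected G" and e: "e \<in> parcs G" and w: "w \<notin> pverts G"
  shows "cut_connected (subdivide G e w)"
  unfolding cut_connected_def
proof (intro allI impI)
  fix C assume C: "C \<subseteq> pverts (subdivide G e w)" "C \<noteq> {}" "C \<noteq> pverts (subdivide G e w)"
  interpret S: pair_graph "subdivide G e w" using e w by (rule pair_graph_subdivide)
  obtain a b where ab: "e = (a, b)" by (cases e)
  have a: "a \<in> pverts G" "a \<noteq> w" using e w in_arcsD1 by (auto simp: ab)
  have aw: "(a, w) \<in> parcs (subdivide G e w)" "(w, a) \<in> parcs (subdivide G e w)" by (auto simp: ab)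
  consider "C - {w} = {}" | "C - {w} = pverts G" | "C - {w} \<noteq> {}" "C - {w} \<noteq> pverts G" by blast
  then show "cut_arcs (subdivide G e w) C \<noteq> {}"
  proof cases
    case 1
    then have "C = {w}" using C by blast
    then show ?thesis using a aw by (auto simp: cut_arcs_def)
  next
    case 2
    then have "C = pverts G" using C w by auto
    then show ?thesis using a aw w by (auto simp: cut_arcs_def)
  next
    case 3
    moreover have "C - {w} \<subseteq> pverts G" using C by auto
    ultimately have "cut_arcs G (C - {w}) \<noteq> {}" using conn unfolding cut_connected_def by blast
    moreover have "cut_arcs G (C - {w}) = cut_arcs G C"
      using w by (auto simp: cut_arcs_def dest: wellformed')
    ultimately have "0 < card (cut_arcs G C)" by (simp add: card_gt_0_iff)
    then have "0 < card (cut_arcs (subdivide G e w) C)"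
      using card_cut_arcs_subdivide[OF e w, of C] by linarith
    then show ?thesis by auto
  qed
qed

text \<open>Adding \<open>w\<close> to a vertex set raises the allowed number of arcs by two. If
  both ends of \<open>e\<close> are present, four arcs replace two; otherwise at most one edge at
  \<open>w\<close> is new.\<close>

lemma forest_off_subdivide:
  assumes forest: "forest_off G U" and e: "e \<in> parcs G" and w: "w \<notin> pverts G"
  shows "forest_off (subdivide G e w) U"
  unfolding forest_off_def
proof (intro allI impI)
  fix Y assume Y: "Y \<subseteq> pverts (subdivide G e w)" "Y \<noteq> {}" "card (Y \<inter> U) \<le> 1"
  interpret S: pair_graph "subdivide G e w" using e w by (rule pair_graph_subdivide)
  obtain a b where ab: "e = (a, b)" by (cases e)
  have arcs: "(a, b) \<in> parcs G" "(b, a) \<in> parcs G" "a \<noteq> b"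
    using e arcs_symmetric no_loops' by (auto simp: ab)
  have new: "(w, c) \<notin> parcs G" "(c, w) \<notin> parcs G" for c using w by (auto dest: wellformed')
  have finY: "finite Y" using Y S.pair_finite_verts by (metis finite_subset)
  define Z where "Z = Y - {w}"
  have Z: "Z \<subseteq> pverts G" using Y by (auto simp: Z_def)
  have "card (Z \<inter> U) \<le> card (Y \<inter> U)"
    using finY by (intro card_mono) (auto simp: Z_def)
  then have bound: "card (inner_arcs G Z) + 2 \<le> 2 * card Z" if "Z \<noteq> {}"
    using forest Z Y that unfolding forest_off_def by (meson le_trans)
  show "card (inner_arcs (subdivide G e w) Y) + 2 \<le> 2 * card Y"
  proof (cases "w \<in> Y")
    case False
    then have "inner_arcs (subdivide G e w) Y \<subseteq> inner_arcs G Z"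
      by (auto simp: inner_arcs_def ab Z_def)
    then have "card (inner_arcs (subdivide G e w) Y) \<le> card (inner_arcs G Z)"
      by (intro card_mono) auto
    then show ?thesis using bound False Y by (simp add: Z_def)
  next
    case True
    then have cardY: "card Y = Suc (card Z)"
      using finY unfolding Z_def by (metis card_Suc_Diff1)
    \<comment> \<open>In the last case \<open>c\<close> is the only end of \<open>e\<close> in
      \<open>Z\<close>, or arbitrary if there is none. The case \<open>Z = {}\<close> is separate
      because \<open>bound\<close> requires a nonempty set.\<close>
    consider "Z = {}" | "Z \<noteq> {}" "a \<in> Z" "b \<in> Z" | c where "Z \<noteq> {}" "\<And>d. d \<in> {a, b} \<Longrightarrow> d \<in> Z \<Longrightarrow> d = c"
      by blast
    then show ?thesis
    proof cases
      case 1
      then have "Y = {w}" using True by (auto simp: Z_def)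
      then have "inner_arcs (subdivide G e w) Y = {}"
        using S.no_loops' by (auto simp: inner_arcs_def)
      then show ?thesis using cardY by simp
    next
      case 2
      let ?A = "{(a, w), (w, a), (b, w), (w, b)}"
      have "inner_arcs (subdivide G e w) Y \<subseteq> (inner_arcs G Z - {(a, b), (b, a)}) \<union> ?A"
        using new by (auto simp: inner_arcs_def ab Z_def)
      then have "card (inner_arcs (subdivide G e w) Y) \<le> card ((inner_arcs G Z - {(a, b), (b, a)}) \<union> ?A)"
        by (intro card_mono) auto
      also have "\<dots> \<le> card (inner_arcs G Z - {(a, b), (b, a)}) + card ?A" by (rule card_Un_le)
      also have "card ?A \<le> 4"
        using card_length[of "[(a, w), (w, a), (b, w), (w, b)]"] by simp
      finally have "card (inner_arcs (subdivide G e w) Y) \<le> card (inner_arcs G Z - {(a, b), (b, a)}) + 4"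
        by simp
      moreover have "card (inner_arcs G Z - {(a, b), (b, a)}) = card (inner_arcs G Z) - card {(a, b), (b, a)}"
        using arcs 2 by (intro card_Diff_subset) (auto simp: inner_arcs_def)
      moreover have "card {(a, b), (b, a)} = 2" using arcs by auto
      moreover have "card {(a, b), (b, a)} \<le> card (inner_arcs G Z)"
        using arcs 2 by (intro card_mono) (auto simp: inner_arcs_def)
      ultimately show ?thesis using bound[OF 2(1)] cardY by linarith
    next
      case (3 c)
      have "inner_arcs (subdivide G e w) Y \<subseteq> inner_arcs G Z \<union> {(c, w), (w, c)}"
      proof
        fix x assume x: "x \<in> inner_arcs (subdivide G e w) Y"
        then consider "x \<in> parcs G" | d where "d \<in> {a, b}" "x = (d, w) \<or> x = (w, d)"
          unfolding inner_arcs_def ab arcs_subdivide by blast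
        then show "x \<in> inner_arcs G Z \<union> {(c, w), (w, c)}"
        proof cases
          case 1
          then show ?thesis using x new by (cases x) (auto simp: inner_arcs_def Z_def)
        next
          case 2
          then have "d \<in> Z" using x e w in_arcsD1[OF arcs(1)] in_arcsD2[OF arcs(1)]
            by (auto simp: inner_arcs_def Z_def)
          then show ?thesis using 2 3(2) by blast
        qed
      qed
      then have "card (inner_arcs (subdivide G e w) Y) \<le> card (inner_arcs G Z \<union> {(c, w), (w, c)})"
        by (intro card_mono) auto
      also have "\<dots> \<le> card (inner_arcs G Z) + card {(c, w), (w, c)}" by (rule card_Un_le)
      also have "card {(c, w), (w, c)} \<le> 2" using card_length[of "[(c, w), (w, c)]"] by simp
      finally show ?thesis using bound[OF 3(1)] cardY by linarith
    qed
  qed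
qed

text \<open>Induction over single subdivisions, supplying in each step that the intermediate graph
  is again a pair graph.\<close>

lemma subdivision_pair_invariant:
  assumes "subdivision_pair G H" and base: "P G"
    and step: "\<And>I e w. pair_graph I \<Longrightarrow> e \<in> parcs I \<Longrightarrow> w \<notin> pverts I \<Longrightarrow> P I \<Longrightarrow> P (subdivide I e w)"
  shows "P H"
  using assms(1)
proof (induct rule: subdivision_pair_induct)
  case base
  show ?case by (rule assms(2))
next
  case (divide e w H)
  then show ?case by (intro step pair_graph_subdivision)
qed

end

section \<open>Complete multipartite graphs\<close>

locale multipartite = pair_graph K for K :: "'a pair_pre_digraph" +
  fixes s :: nat and n :: "nat \<Rightarrow> nat" and V :: "nat \<Rightarrow> 'a set"
  assumes parts: "2 \<le> s"
    and n_pos: "1 \<le> n 1" and n_mono: "mono_on {1..s} n"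
    and verts_K: "pverts K = (\<Union>i\<in>{1..s}. V i)"
    and disj: "disjoint_family_on V {1..s}"
    and card_V: "\<And>i. i \<in> {1..s} \<Longrightarrow> card (V i) = n i"
    and arcs_K: "parcs K = {(v, w). \<exists>i\<in>{1..s}. \<exists>j\<in>{1..s}. i \<noteq> j \<and> v \<in> V i \<and> w \<in> V j}"
begin

text \<open>The support of the divisor for the upper bound; by monotonicity of \<open>n\<close> the
  omitted part \<open>V s\<close> has maximal size.\<close>

definition small_parts :: "'a set" where
  "small_parts = (\<Union>i\<in>{1..s-1}. V i)"

lemma finite_V: "i \<in> {1..s} \<Longrightarrow> finite (V i)"
  using pair_finite_verts by (auto simp: verts_K)

lemma part_unique: "v \<in> V i \<Longrightarrow> v \<in> V j \<Longrightarrow> i \<in> {1..s} \<Longrightarrow> j \<in> {1..s} \<Longrightarrow> i = j"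
  using disj unfolding disjoint_family_on_def by blast

lemma arcs_KI:
  "i \<in> {1..s} \<Longrightarrow> j \<in> {1..s} \<Longrightarrow> i \<noteq> j \<Longrightarrow> v \<in> V i \<Longrightarrow> w \<in> V j \<Longrightarrow> (v, w) \<in> parcs K"
  unfolding arcs_K by blast

lemma n_le: "i \<in> {1..s} \<Longrightarrow> n i \<le> n s"
  using n_mono parts by (auto simp: mono_on_def)

lemma n_s_pos: "1 \<le> n s"
  using n_le[of 1] n_pos parts by simp

lemma card_parts:
  assumes "I \<subseteq> {1..s}"
  shows "card (\<Union>i\<in>I. V i) = (\<Sum>i\<in>I. n i)"
proof -
  have "card (\<Union>i\<in>I. V i) = (\<Sum>i\<in>I. card (V i))"
    using assms disj finite_V finite_subset[OF assms]
    by (intro card_UN_disjoint) (auto simp: disjoint_family_on_def)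
  also have "\<dots> = (\<Sum>i\<in>I. n i)" using assms card_V by (intro sum.cong) auto
  finally show ?thesis .
qed

lemma card_small_parts: "card small_parts = (\<Sum>i=1..s-1. n i)"
  unfolding small_parts_def by (rule card_parts) auto

lemma sum_all_parts: "(\<Sum>i=1..s. n i) = (\<Sum>i=1..s-1. n i) + n s"
proof -
  have "{1..s} = insert s {1..s-1}" "s \<notin> {1..s-1}" using parts by auto
  then show ?thesis by (metis add.commute finite_atLeastAtMost sum.insert)
qed

lemma card_verts: "card (pverts K) = (\<Sum>i=1..s-1. n i) + n s"
  unfolding verts_K card_parts[OF subset_refl] by (rule sum_all_parts)

lemma small_parts_subset: "small_parts \<subseteq> pverts K"
  unfolding small_parts_def verts_K by (rule UN_mono) auto

lemma small_parts_nonempty: "small_parts \<noteq> {}"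
proof -
  have "V 1 \<noteq> {}" using card_V[of 1] n_pos parts by auto
  then show ?thesis using parts by (auto simp: small_parts_def)
qed

text \<open>If \<open>U\<close> splits a part \<open>V i\<close>, every vertex outside
  \<open>V i\<close> contributes its own cut edge. If no part is split, the cut is complete
  bipartite between the two sides.\<close>

lemma card_cut_lower_bound:
  assumes "pverts K \<inter> U \<noteq> {}" "pverts K - U \<noteq> {}"
  shows "(\<Sum>i=1..s-1. n i) \<le> card (cut_arcs K U)"
proof (cases "\<exists>i\<in>{1..s}. V i \<inter> U \<noteq> {} \<and> V i - U \<noteq> {}")
  case True
  then obtain i p q where i: "i \<in> {1..s}" and pq: "p \<in> V i" "p \<in> U" "q \<in> V i" "q \<notin> U" by blast
  define R where "R = (\<Union>j\<in>{1..s} - {i}. V j)"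
  \<comment> \<open>Every \<open>r\<close> is adjacent to \<open>p\<close> in \<open>U\<close> and
    to \<open>q\<close> outside it; exactly one of the two edges crosses the cut.\<close>
  define \<phi> where "\<phi> r = (if r \<in> U then (r, q) else (p, r))" for r
  have notin: "p \<notin> R" "q \<notin> R" using pq i part_unique by (auto simp: R_def)
  have "(\<Sum>j=1..s. n j) = n i + (\<Sum>j\<in>{1..s} - {i}. n j)" using i by (simp add: sum.remove)
  then have "(\<Sum>j=1..s-1. n j) \<le> (\<Sum>j\<in>{1..s} - {i}. n j)" using n_le[OF i] sum_all_parts by linarith
  also have "\<dots> = card R" unfolding R_def by (rule card_parts[symmetric]) auto
  also have "card R \<le> card (cut_arcs K U)"
  proof (rule card_inj_on_le)
    show "inj_on \<phi> R" using notin by (auto simp: inj_on_def \<phi>_def split: if_splits)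
    show "\<phi> ` R \<subseteq> cut_arcs K U"
    proof
      fix x assume "x \<in> \<phi> ` R"
      then obtain j r where r: "j \<in> {1..s}" "j \<noteq> i" "r \<in> V j" "x = \<phi> r"
        unfolding R_def by blast
      have "(r, q) \<in> parcs K" "(p, r) \<in> parcs K"
        using arcs_KI[OF r(1) i r(2,3) pq(3)] arcs_KI[OF i r(1) r(2)[symmetric] pq(1) r(3)]
        by simp_all
      then show "x \<in> cut_arcs K U" using pq r by (simp add: \<phi>_def cut_arcs_def)
    qed
  qed simp
  finally show ?thesis .
next
  case False
  let ?A = "pverts K \<inter> U" and ?B = "pverts K - U"
  have "?A \<times> ?B \<subseteq> cut_arcs K U"
  proof (rule subrelI)
    fix v w assume "(v, w) \<in> ?A \<times> ?B"
    then have vw: "v \<in> pverts K" "v \<in> U" "w \<in> pverts K" "w \<notin> U" by auto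
    then obtain i j where ij: "i \<in> {1..s}" "j \<in> {1..s}" "v \<in> V i" "w \<in> V j"
      unfolding verts_K by blast
    then have "i \<noteq> j" using False vw by blast
    with ij have "(v, w) \<in> parcs K" by (auto intro: arcs_KI)
    then show "(v, w) \<in> cut_arcs K U" using vw by (simp add: cut_arcs_def)
  qed
  then have "card ?A * card ?B \<le> card (cut_arcs K U)"
    unfolding card_cartesian_product[symmetric] by (intro card_mono) auto
  moreover have "1 \<le> card ?A" "1 \<le> card ?B"
    using assms pair_finite_verts by (simp_all add: Suc_le_eq card_gt_0_iff)
  \<comment> \<open>This is \<open>(a - 1) * (b - 1) \<ge> 0\<close> for the two sizes; the surplus
    1 is absorbed by \<open>n s \<ge> 1\<close>.\<close>
  then have "card ?A + card ?B \<le> card ?A * card ?B + 1"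
    by (cases "card ?A"; cases "card ?B") auto
  moreover have "card (pverts K) = card ?A + card ?B"
    using pair_finite_verts by (metis card_Int_Diff)
  ultimately show ?thesis using card_verts n_s_pos by linarith
qed

lemma sum_pos: "0 < (\<Sum>i=1..s-1. n i)"
  unfolding card_small_parts[symmetric] card_gt_0_iff
  using small_parts_nonempty small_parts_subset pair_finite_verts by (metis finite_subset)

lemma cut_connected_K: "cut_connected K"
  unfolding cut_connected_def
proof (intro allI impI)
  fix C assume "C \<subseteq> pverts K" "C \<noteq> {}" "C \<noteq> pverts K"
  then have "(\<Sum>i=1..s-1. n i) \<le> card (cut_arcs K C)" by (intro card_cut_lower_bound) auto
  then show "cut_arcs K C \<noteq> {}" using sum_pos by auto
qed

text \<open>Outside \<open>small_parts\<close> only the independent set \<open>V s\<close> remains,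
  so all edges within \<open>Y\<close> form a star around its single vertex in
  \<open>small_parts\<close>, if there is one.\<close>

lemma forest_off_small_parts: "forest_off K small_parts"
  unfolding forest_off_def
proof (intro allI impI)
  fix Y assume Y: "Y \<subseteq> pverts K" "Y \<noteq> {}" "card (Y \<inter> small_parts) \<le> 1"
  have fin: "finite Y" using Y pair_finite_verts by (metis finite_subset)
  have large: "(v, w) \<notin> parcs K" if "v \<in> Y - small_parts" "w \<in> Y - small_parts" for v w
  proof -
    have "i = s" if "i \<in> {1..s}" "u \<in> V i" "u \<notin> small_parts" for i u
      using that by (force simp: small_parts_def)
    then show ?thesis using that unfolding arcs_K by blast
  qed
  show "card (inner_arcs K Y) + 2 \<le> 2 * card Y"
  proof (cases "Y \<inter> small_parts = {}")
    case True
    then have "inner_arcs K Y = {}" using large by (auto simp: inner_arcs_def)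
    moreover have "0 < card Y" using Y fin by (simp add: card_gt_0_iff)
    ultimately show ?thesis by simp
  next
    case False
    then have "card (Y \<inter> small_parts) = 1" using Y(3) fin by (simp add: card_eq_0_iff le_Suc_eq)
    then obtain u where u: "Y \<inter> small_parts = {u}" by (rule card_1_singletonE)
    let ?Z = "Y - {u}"
    have Z: "?Z = Y - small_parts" "u \<in> Y" using u by auto
    have "inner_arcs K Y \<subseteq> Pair u ` ?Z \<union> (\<lambda>w. (w, u)) ` ?Z"
    proof
      fix x assume x: "x \<in> inner_arcs K Y"
      obtain v w where vw: "x = (v, w)" by (cases x)
      show "x \<in> Pair u ` ?Z \<union> (\<lambda>w. (w, u)) ` ?Z"
        using x large[of v w] no_loops'[of v w] unfolding Z(1)[symmetric]
        by (auto simp: vw inner_arcs_def)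
    qed
    then have "card (inner_arcs K Y) \<le> card (Pair u ` ?Z \<union> (\<lambda>w. (w, u)) ` ?Z)"
      using fin by (intro card_mono) auto
    also have "\<dots> \<le> card (Pair u ` ?Z) + card ((\<lambda>w. (w, u)) ` ?Z)" by (rule card_Un_le)
    also have "\<dots> \<le> card ?Z + card ?Z" using fin by (intro add_mono card_image_le) auto
    finally show ?thesis using card_Suc_Diff1[OF fin Z(2)] by linarith
  qed
qed

text \<open>The forest property, connectedness and the lower bound for cuts are inherited by
  \<open>G\<close> from \<open>K\<close>; the first two give the divisor, the last the minimality of
  its degree.\<close>

theorem gonality_subdivision:
  assumes sub: "subdivision_pair K G"
  shows "\<exists>D\<in>divisors (with_proj G). divisor_degree (with_proj G) D = int (\<Sum>i=1..s-1. n i) \<and>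
      1 \<le> divisor_rank (with_proj G) D"
    and "gonality (with_proj G) = int (\<Sum>i=1..s-1. n i)"
proof -
  interpret G: pair_graph G using sub by (rule pair_graph_subdivision)
  have verts: "pverts K \<subseteq> pverts G"
    using subdivision_verts_subset[OF sub] by auto
  have U: "small_parts \<subseteq> pverts G" using small_parts_subset verts by blast
  have conn: "cut_connected G"
    by (rule subdivision_pair_invariant[OF sub cut_connected_K pair_graph.cut_connected_subdivide])
  have forest: "forest_off G small_parts"
    by (rule subdivision_pair_invariant[where P = "\<lambda>H. forest_off H small_parts",
          OF sub forest_off_small_parts pair_graph.forest_off_subdivide])
  \<comment> \<open>The set \<open>W\<close> may contain subdivision vertices;
    \<open>cut_arcs K W\<close> sees only its trace on the vertices of \<open>K\<close>.\<close>
  have cuts: "card (cut_arcs K W) \<le> card (cut_arcs G W)" for W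
    by (rule subdivision_pair_invariant[where P = "\<lambda>H. card (cut_arcs K W) \<le> card (cut_arcs H W)",
          OF sub le_refl])
      (meson le_trans pair_graph.card_cut_arcs_subdivide)
  show ex: "\<exists>D\<in>divisors (with_proj G). divisor_degree (with_proj G) D = int (\<Sum>i=1..s-1. n i) \<and>
      1 \<le> divisor_rank (with_proj G) D"
    using G.indicator_in_divisors[OF U] G.degree_indicator[OF U]
      G.rank_indicator_of_forest_off[OF forest conn U small_parts_nonempty]
    unfolding card_small_parts by blast
  have lower: "int (\<Sum>i=1..s-1. n i) \<le> divisor_degree (with_proj G) D"
    if "D \<in> divisors (with_proj G)" "1 \<le> divisor_rank (with_proj G) D" for D
  proof (rule G.degree_lower_bound_of_cuts[OF that verts])
    show "pverts K \<noteq> {}" using small_parts_subset small_parts_nonempty by blast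
    show "(\<Sum>i=1..s-1. n i) \<le> card (pverts K)" by (simp add: card_verts)
    show "(\<Sum>i=1..s-1. n i) \<le> card (cut_arcs G W)"
      if "pverts K \<inter> W \<noteq> {}" "pverts K - W \<noteq> {}" for W
      using card_cut_lower_bound[OF that] cuts[of W] by linarith
  qed
  show "gonality (with_proj G) = int (\<Sum>i=1..s-1. n i)"
    unfolding gonality_def by (rule Least_equality) (use ex lower in blast)+
qed

end

theorem proposition6p1p1:
  fixes s :: nat and n :: "nat \<Rightarrow> nat" and K G :: "'a pair_pre_digraph"
  assumes "2 \<le> s"
    and "1 \<le> n 1"
    and "mono_on {1..s} n"
    and "complete_multipartite_digraph s n (with_proj K)"
    and "subdivision_pair K G"
  shows "(\<exists>D\<in>divisors (with_proj G).
            divisor_degree (with_proj G) D = int (\<Sum>i=1..s-1. n i) \<and>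
            1 \<le> divisor_rank (with_proj G) D) \<and>
         gonality (with_proj G) = int (\<Sum>i=1..s-1. n i)"
proof -
  from assms(4) obtain V where K: "graph (with_proj K)"
    and V: "pverts K = (\<Union>i\<in>{1..s}. V i)" "disjoint_family_on V {1..s}"
      "\<forall>i\<in>{1..s}. card (V i) = n i"
      "parcs K = {(v, w). \<exists>i\<in>{1..s}. \<exists>j\<in>{1..s}. i \<noteq> j \<and> v \<in> V i \<and> w \<in> V j}"
    unfolding complete_multipartite_digraph_def with_proj_simps by blast
  interpret pair_graph K using K by (rule pair_graphI_graph)
  interpret multipartite K s n V
    using assms(1-3) V by unfold_locales auto
  show ?thesis using gonality_subdivision[OF assms(5)] by blast
qed

end
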